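(* Let $q$ be a prime power (even or odd). The weight-distribution bound is tight for the negative non-principal eigenvalue $-(q+1)$ of $Sp(4,q)$; that is, there exists an eigenfunction of $Sp(4,q)$ corresponding to the eigenvalue $-(q+1)$ that has exactly $2(q+1)$ non-zero values.
   Context: The graph $Sp(4,q)$ has the points of $\mathrm{PG}(3,q)$ as vertices, two distinct points $x,y$ being adjacent iff $y\in x^\zeta$, where $\zeta$ is a given symplectic polarity of $\mathrm{PG}(3,q)$ (a polarity with $x\in x^\zeta$ for every point $x$). It is a primitive strongly regular graph with eigenvalues $q(q+1)$ (principal), $q-1$ and $-(q+1)$. For a graph $G$ with eigenvalue $\theta$, a real-valued function $f\not\equiv 0$ on its vertex set is an eigenfunction corresponding to $\theta$ if $\theta f(u)=\sum_{w\in G(u)}f(w)$ for every vertex $u$, where $G(u)$ is the set of neighbours of $u$. The weight-distribution bound for a primitive strongly regular graph with non-principal eigenvalues $s<0<r$ states that an eigenfunction corresponding to $s$ has at least $-2s$ non-zeroes (and one corresponding to $r$ has at least $2(r+1)$ non-zeroes). The bound is tight for an eigenvalue if some eigenfunction corresponding to that eigenvalue attains it with equality. *)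

theory Defs
  imports "HOL-Analysis.Analysis"
begin

text \<open>
  The subspaces of \<open>PG(3,q)\<close> are encoded as the linear subspaces of \<open>F^4\<close>, where \<open>F\<close> is a field
  with \<open>q\<close> elements; the points are the one-dimensional ones. Incidence is inclusion, so ``the
  point \<open>y\<close> lies in \<open>U\<close>'' is written \<open>y \<subseteq> U\<close>.
\<close>

definition pg_points :: "('a::field ^ 'n) set set" where
  "pg_points = {x. vec.subspace x \<and> vec.dim x = 1}"

text \<open>
  A polarity is an inclusion-reversing permutation of order two of the set of subspaces.
  Bijectivity follows from \<open>\<zeta> (\<zeta> U) = U\<close>, and an inclusion-reversing map is not the identity.
  Values of \<open>\<zeta>\<close> outside the set of subspaces are irrelevant.
\<close>

definition polarity :: "(('a::field ^ 'n) set \<Rightarrow> ('a ^ 'n) set) \<Rightarrow> bool" where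
  "polarity \<zeta> \<longleftrightarrow>
     (\<forall>U. vec.subspace U \<longrightarrow> vec.subspace (\<zeta> U) \<and> \<zeta> (\<zeta> U) = U) \<and>
     (\<forall>U W. vec.subspace U \<longrightarrow> vec.subspace W \<longrightarrow> U \<subseteq> W \<longrightarrow> \<zeta> W \<subseteq> \<zeta> U)"

definition symplectic_polarity :: "(('a::field ^ 'n) set \<Rightarrow> ('a ^ 'n) set) \<Rightarrow> bool" where
  "symplectic_polarity \<zeta> \<longleftrightarrow> polarity \<zeta> \<and> (\<forall>x\<in>pg_points. x \<subseteq> \<zeta> x)"

text \<open>A graph is given by its vertex set \<open>V\<close> and its adjacency relation \<open>E\<close>.\<close>

definition neighbours :: "'v set \<Rightarrow> ('v \<Rightarrow> 'v \<Rightarrow> bool) \<Rightarrow> 'v \<Rightarrow> 'v set" where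
  "neighbours V E u = {w \<in> V. E u w}"

definition eigenfunction ::
    "'v set \<Rightarrow> ('v \<Rightarrow> 'v \<Rightarrow> bool) \<Rightarrow> real \<Rightarrow> ('v \<Rightarrow> real) \<Rightarrow> bool" where
  "eigenfunction V E \<theta> f \<longleftrightarrow>
     (\<exists>u\<in>V. f u \<noteq> 0) \<and> (\<forall>u\<in>V. \<theta> * f u = (\<Sum>w\<in>neighbours V E u. f w))"

definition nonzeroes :: "'v set \<Rightarrow> ('v \<Rightarrow> real) \<Rightarrow> 'v set" where
  "nonzeroes V f = {u \<in> V. f u \<noteq> 0}"

text \<open>
  For a primitive strongly regular graph with non-principal eigenvalues \<open>s < 0 < r\<close>, the lower
  bound on the number of non-zeroes is \<open>- 2 s\<close> for \<open>s\<close> and \<open>2 (r + 1)\<close> for \<open>r\<close>.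
\<close>

definition weight_distribution_bound :: "real \<Rightarrow> real" where
  "weight_distribution_bound \<theta> = (if \<theta> < 0 then - 2 * \<theta> else 2 * (\<theta> + 1))"

definition weight_distribution_bound_tight ::
    "'v set \<Rightarrow> ('v \<Rightarrow> 'v \<Rightarrow> bool) \<Rightarrow> real \<Rightarrow> bool" where
  "weight_distribution_bound_tight V E \<theta> \<longleftrightarrow>
     (\<exists>f. eigenfunction V E \<theta> f \<and> real (card (nonzeroes V f)) = weight_distribution_bound \<theta>)"

definition Sp4_vertices :: "('a::field ^ 4) set set" where
  "Sp4_vertices = pg_points"

definition Sp4_adj ::
    "(('a::field ^ 4) set \<Rightarrow> ('a ^ 4) set) \<Rightarrow> ('a ^ 4) set \<Rightarrow> ('a ^ 4) set \<Rightarrow> bool" where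
  "Sp4_adj \<zeta> x y \<longleftrightarrow> x \<in> pg_points \<and> y \<in> pg_points \<and> x \<noteq> y \<and> y \<subseteq> \<zeta> x"

end

theory Submission imports Defs begin

text \<open>
  Let \<open>L\<close> be a hyperbolic line, that is, the join of two points \<open>a\<close>, \<open>b\<close> with \<open>b\<close> not in \<open>\<zeta> a\<close>.
  Then \<open>L\<close> and \<open>\<zeta> L\<close> are disjoint lines. The eigenfunction is \<open>1\<close> on the \<open>q + 1\<close> points of \<open>L\<close>,
  \<open>- 1\<close> on the \<open>q + 1\<close> points of \<open>\<zeta> L\<close>, and \<open>0\<close> elsewhere: a point of \<open>L\<close> is adjacent to every
  point of \<open>\<zeta> L\<close> and to no point of \<open>L\<close>, and the plane \<open>\<zeta> u\<close> of a point \<open>u\<close> outside both lines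
  meets each of them in exactly one point.
\<close>

section \<open>Points and lines of a projective space\<close>

lemma pg_points_iff: "x \<in> pg_points \<longleftrightarrow> (\<exists>v. v \<noteq> 0 \<and> x = vec.span {v})"
proof
  assume x: "x \<in> pg_points"
  then have "vec.subspace x" "vec.dim x = 1"
    by (auto simp: pg_points_def)
  then obtain B where B: "vec.span B = x" "card B = 1" "vec.independent B"
    using vec.basis_subspace_exists by metis
  then obtain v where "B = {v}"
    by (auto simp: card_1_singleton_iff)
  with B have "v \<noteq> 0" "x = vec.span {v}"
    by auto
  then show "\<exists>v. v \<noteq> 0 \<and> x = vec.span {v}"
    by blast
qed (auto simp: pg_points_def)

lemma subspace_pg_point: "x \<in> pg_points \<Longrightarrow> vec.subspace x"
  by (simp add: pg_points_def)

lemma pg_point_span: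
  assumes "x \<in> pg_points" "v \<in> x" "v \<noteq> 0"
  shows "x = vec.span {v}"
proof (rule sym, rule vec.subspace_dim_equal)
  show "vec.span {v} \<subseteq> x"
    using assms by (simp add: vec.span_minimal subspace_pg_point)
  show "vec.subspace x" "vec.dim x \<le> vec.dim (vec.span {v})"
    using assms(1,3) by (simp_all add: pg_points_def)
qed (rule vec.subspace_span)

lemma pg_point_not_subset_zero: "x \<in> pg_points \<Longrightarrow> \<not> x \<subseteq> {0}"
  using vec.dim_eq_0[of x] by (simp add: pg_points_def)

lemma ex_pg_point_subset:
  assumes "vec.subspace U" "\<not> U \<subseteq> {0}"
  shows "\<exists>x\<in>pg_points. x \<subseteq> U"
proof -
  obtain v where "v \<in> U" "v \<noteq> 0"
    using assms by auto
  then show ?thesis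
    using assms(1) by (intro bexI[of _ "vec.span {v}"]) (auto simp: pg_points_iff vec.span_minimal)
qed

text \<open>If \<open>S \<inter> W\<close> had dimension at most 1, each point inside it would be
  all of it, so \<open>x = y\<close>. Hence the intersection has dimension 2 and exhausts
  \<open>S\<close>.\<close>

lemma line_subset_if_two_points:
  assumes S: "vec.subspace S" "vec.dim S = 2" and W: "vec.subspace W"
    and x: "x \<in> pg_points" "x \<subseteq> S" "x \<subseteq> W"
    and y: "y \<in> pg_points" "y \<subseteq> S" "y \<subseteq> W"
    and ne: "x \<noteq> y"
  shows "S \<subseteq> W"
proof -
  have "vec.dim (S \<inter> W) > 1"
  proof (rule ccontr)
    assume "\<not> vec.dim (S \<inter> W) > 1"
    then have "z = S \<inter> W" if "z \<in> pg_points" "z \<subseteq> S" "z \<subseteq> W" for z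
      using that S W by (intro vec.subspace_dim_equal) (auto simp: pg_points_def vec.subspace_inter)
    with x y ne show False
      by metis
  qed
  then have "S \<inter> W = S"
    using S W by (intro vec.subspace_dim_equal) (auto simp: vec.subspace_inter)
  then show ?thesis
    by blast
qed

text \<open>For a basis \<open>a\<close>, \<open>b\<close> of \<open>S\<close>, the points are the
  spans of \<open>a + c *s b\<close>, one for each scalar \<open>c\<close>, together with the span
  of \<open>b\<close>, the "point at infinity".\<close>

lemma card_pg_points_line:
  fixes S :: "('a::{field,finite} ^ 'n) set"
  assumes "vec.subspace S" "vec.dim S = 2"
  shows "card {w \<in> pg_points. w \<subseteq> S} = CARD('a) + 1"
proof -
  obtain B where B: "vec.independent B" "vec.span B = S" "card B = 2"
    using vec.basis_subspace_exists[OF assms(1)] assms(2) by metis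
  then obtain a b where ab: "B = {a, b}" "a \<noteq> b"
    by (auto simp: card_2_iff)
  have a: "a \<notin> vec.span {b}" and b: "b \<noteq> 0"
    using B(1) ab by (auto simp: vec.independent_insert)
  let ?p = "\<lambda>c. vec.span {a + c *s b}"
  have S: "x \<in> S \<longleftrightarrow> (\<exists>k l. x = k *s a + l *s b)" for x
    unfolding B(2)[symmetric] ab(1) vec.span_breakdown_eq[of x a] vec.span_singleton
    by (auto simp: image_iff diff_eq_eq add.commute)
  have nz: "a + c *s b \<noteq> 0" for c
  proof
    assume "a + c *s b = 0"
    then have "a = (- c) *s b"
      by (simp add: eq_neg_iff_add_eq_0)
    moreover have "(- c) *s b \<in> vec.span {b}"
      by (intro vec.span_scale vec.span_base) simp
    ultimately show False
      using a by metis
  qed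
  have coeff: "k = k' \<and> l = l'" if "k *s a + l *s b = k' *s a + l' *s b" for k l k' l'
  proof -
    have eq: "(k - k') *s a = (l' - l) *s b"
      using that by (simp add: algebra_simps)
    have "k = k'"
    proof (rule ccontr)
      assume "k \<noteq> k'"
      then have "a = inverse (k - k') *s ((k - k') *s a)"
        by (simp only: vec.scale_scale) simp
      also have "\<dots> = (inverse (k - k') * (l' - l)) *s b"
        unfolding eq by (simp only: vec.scale_scale)
      finally show False
        using a by (metis rangeI vec.span_singleton)
    qed
    with eq b show ?thesis
      by simp
  qed
  have "inj ?p"
  proof (rule injI)
    fix c d assume "?p c = ?p d"
    then have "a + c *s b \<in> ?p d"
      by (metis singletonI vec.span_base)
    then obtain k where "a + c *s b = k *s (a + d *s b)"
      by (auto simp: vec.span_singleton)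
    \<comment> \<open>The factor \<open>1\<close> is written out so that \<open>coeff\<close>
      applies: comparing coefficients of \<open>a\<close> forces \<open>k = 1\<close>, and those of
      \<open>b\<close> then give \<open>c = d\<close>.\<close>
    then have "1 *s a + c *s b = k *s a + (k * d) *s b"
      by (simp add: algebra_simps)
    from coeff[OF this] show "c = d"
      by auto
  qed
  moreover have "vec.span {b} \<notin> range ?p"
  proof
    assume "vec.span {b} \<in> range ?p"
    then obtain c where "a + c *s b \<in> vec.span {b}"
      by (metis (no_types, lifting) imageE singletonI vec.span_base)
    then have "(a + c *s b) - c *s b \<in> vec.span {b}"
      by (rule vec.span_diff) (simp add: vec.span_scale vec.span_base)
    with a show False
      by (simp only: add_diff_cancel_right')
  qed
  moreover have "{w \<in> pg_points. w \<subseteq> S} = insert (vec.span {b}) (range ?p)"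
  proof (intro equalityI subsetI)
    fix w assume "w \<in> {w \<in> pg_points. w \<subseteq> S}"
    then obtain v where v: "v \<noteq> 0" "w = vec.span {v}" "w \<in> pg_points" "v \<in> S"
      by (auto simp: pg_points_iff intro: vec.span_base)
    then obtain k l where kl: "v = k *s a + l *s b"
      using S by blast
    \<comment> \<open>If the coefficient of \<open>a\<close> vanishes, then \<open>l\<close> is
      nonzero because \<open>v\<close> is, and the point is the span of \<open>b\<close>. Otherwise
      the coefficient of \<open>a\<close> is scaled to 1.\<close>
    show "w \<in> insert (vec.span {b}) (range ?p)"
    proof (cases "k = 0")
      case True
      with kl v have "b = inverse l *s v"
        by auto
      then have "b \<in> w"
        by (metis rangeI v(2) vec.span_singleton)
      then show ?thesis
        using pg_point_span[OF v(3)] b by simp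
    next
      case False
      then have "a + (inverse k * l) *s b = inverse k *s v"
        by (simp add: kl algebra_simps)
      then have "a + (inverse k * l) *s b \<in> w"
        by (metis rangeI v(2) vec.span_singleton)
      then show ?thesis
        using pg_point_span[OF v(3)] nz by blast
    qed
  next
    have "a \<in> S" "b \<in> S"
      using B(2) ab(1) vec.span_base by blast+
    then have "vec.span {b} \<subseteq> S" "?p c \<subseteq> S" for c
      using assms(1)
      by (simp_all add: vec.span_minimal vec.subspace_add vec.subspace_scale)
    then show "w \<in> {w \<in> pg_points. w \<subseteq> S}" if "w \<in> insert (vec.span {b}) (range ?p)" for w
      using that b nz unfolding pg_points_iff by blast
  qed
  ultimately show ?thesis
    by (simp add: card_image)
qed

section \<open>Polarities\<close>

lemma polarity_subspace: "polarity \<zeta> \<Longrightarrow> vec.subspace U \<Longrightarrow> vec.subspace (\<zeta> U)"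
  by (simp add: polarity_def)

lemma polarity_invol: "polarity \<zeta> \<Longrightarrow> vec.subspace U \<Longrightarrow> \<zeta> (\<zeta> U) = U"
  by (simp add: polarity_def)

lemma polarity_subset_swap:
  assumes "polarity \<zeta>" "vec.subspace U" "vec.subspace W" "U \<subseteq> \<zeta> W"
  shows "W \<subseteq> \<zeta> U"
  using assms unfolding polarity_def by metis

text \<open>Being an involution, \<open>\<zeta>\<close> is injective on subspaces, so it reverses
  inclusions strictly.\<close>

lemma polarity_mono_dim:
  assumes "polarity \<zeta>" "vec.subspace U" "vec.subspace W" "U \<subset> W"
  shows "vec.dim (\<zeta> W) < vec.dim (\<zeta> U)"
proof -
  have "\<zeta> W \<subset> \<zeta> U"
    using assms unfolding polarity_def by (metis psubset_eq)
  then show ?thesis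
    using assms by (intro vec.dim_psubset) (simp add: vec.span_eq_iff[THEN iffD2] polarity_subspace)
qed

text \<open>The definition of a polarity speaks of inclusions only, so dimensions are compared along
  a chain. Enlarge \<open>U\<close> by one dimension at a time up to the whole space; each
  enlargement lowers the dimension of the image by at least one. The induction is on the codimension
  of \<open>U\<close>.\<close>

lemma polarity_dim_ge:
  fixes U :: "('a::field ^ 'n) set"
  assumes "polarity \<zeta>" "vec.subspace U"
  shows "CARD('n) \<le> vec.dim U + vec.dim (\<zeta> U)"
  using assms(2)
proof (induction "CARD('n) - vec.dim U" arbitrary: U rule: less_induct)
  case less
  show ?case
  proof (cases "U = UNIV")
    case True
    then show ?thesis
      using vec_dim_card[where 'a='a and 'n='n] by (simp only: le_add1)
  next
    case False
    then obtain v where v: "v \<notin> U"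
      by auto
    define W where "W = vec.span (insert v U)"
    have W: "vec.subspace W" "U \<subset> W" "vec.dim W = vec.dim U + 1"
      using v less.prems vec.span_superset[of "insert v U"]
      by (auto simp: W_def vec.dim_insert vec.span_eq_iff[THEN iffD2])
    have "vec.dim W \<le> CARD('n)"
      by (rule dim_subset_UNIV_cart_gen)
    with W(3) have "CARD('n) \<le> vec.dim W + vec.dim (\<zeta> W)"
      by (intro less.hyps W) auto
    moreover have "vec.dim (\<zeta> W) < vec.dim (\<zeta> U)"
      using assms(1) less.prems W by (intro polarity_mono_dim)
    ultimately show ?thesis
      using W(3) by simp
  qed
qed

text \<open>A point strictly contains \<open>{0}\<close>, so its image is strictly smaller than the
  image of \<open>{0}\<close> and has dimension below \<open>CARD('n)\<close>. The general lower
  bound does the rest: \<open>\<zeta> x\<close> is a hyperplane.\<close>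

lemma polarity_point_dim:
  fixes x :: "('a::field ^ 'n) set"
  assumes "polarity \<zeta>" "x \<in> pg_points"
  shows "vec.dim (\<zeta> x) + 1 = CARD('n)"
proof -
  have x: "vec.subspace x" "vec.dim x = 1"
    using assms by (auto simp: pg_points_def)
  have "vec.dim (\<zeta> x) < vec.dim (\<zeta> {0})"
    using assms x pg_point_not_subset_zero[OF assms(2)] vec.subspace_0
    by (intro polarity_mono_dim) auto
  also have "\<dots> \<le> CARD('n)"
    by (rule dim_subset_UNIV_cart_gen)
  finally show ?thesis
    using polarity_dim_ge[OF assms(1) x(1)] x(2) by simp
qed

section \<open>Hyperbolic lines\<close>

text \<open>Let \<open>L\<close> join \<open>a\<close> to a point \<open>b\<close> outside
  \<open>\<zeta> a\<close>. A common point \<open>p\<close> of \<open>L\<close> and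
  \<open>\<zeta> L\<close> satisfies \<open>L \<subseteq> \<zeta> p\<close>, so \<open>p\<close>
  lies in \<open>\<zeta> a\<close>, and \<open>p\<close> differs from \<open>a\<close> because
  \<open>b\<close> lies in \<open>\<zeta> p\<close>. Then \<open>L\<close> has the two points
  \<open>a\<close> and \<open>p\<close> in \<open>\<zeta> a\<close>, which puts \<open>b\<close>
  there as well.\<close>

lemma ex_hyperbolic_line:
  fixes \<zeta> :: "('a::field ^ 4) set \<Rightarrow> ('a ^ 4) set"
  assumes "symplectic_polarity \<zeta>"
  shows "\<exists>L. vec.subspace L \<and> vec.dim L = 2 \<and> L \<inter> \<zeta> L = {0}"
proof -
  have pol: "polarity \<zeta>" and self: "\<And>x. x \<in> pg_points \<Longrightarrow> x \<subseteq> \<zeta> x"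
    using assms by (auto simp: symplectic_polarity_def)
  define u :: "'a ^ 4" where "u = axis 1 1"
  define a where "a = vec.span {u}"
  have "u \<noteq> 0"
    by (simp add: u_def)
  then have a: "a \<in> pg_points"
    by (auto simp: a_def pg_points_iff)
  have "\<zeta> a \<noteq> UNIV"
    using polarity_point_dim[OF pol a] vec_dim_card[where 'a='a and 'n=4] by auto
  then obtain v where v: "v \<notin> \<zeta> a"
    by auto
  define b where "b = vec.span {v}"
  have "v \<noteq> 0"
    using v polarity_subspace[OF pol] subspace_pg_point[OF a] vec.subspace_0 by blast
  then have b: "b \<in> pg_points"
    by (auto simp: b_def pg_points_iff)
  have nab: "\<not> b \<subseteq> \<zeta> a"
    using v vec.span_base[of v "{v}"] by (auto simp only: b_def)
  define L where "L = vec.span {v, u}"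
  have L: "vec.subspace L" "a \<subseteq> L" "b \<subseteq> L"
    unfolding L_def a_def b_def by (intro vec.subspace_span vec.span_mono; simp)+
  have "v \<notin> a"
    using self[OF a] v by auto
  then have dL: "vec.dim L = 2"
    using \<open>u \<noteq> 0\<close> by (simp add: L_def a_def vec.dim_insert)
  note sub = subspace_pg_point[OF a] subspace_pg_point[OF b] L(1)
  have Z: "vec.subspace (\<zeta> L)" "vec.subspace (\<zeta> a)"
    using polarity_subspace[OF pol] sub by auto
  have "L \<inter> \<zeta> L \<subseteq> {0}"
  proof (rule ccontr)
    assume "\<not> L \<inter> \<zeta> L \<subseteq> {0}"
    then obtain p where p: "p \<in> pg_points" "p \<subseteq> L" "p \<subseteq> \<zeta> L"
      using ex_pg_point_subset[of "L \<inter> \<zeta> L"] L(1) Z by (auto simp: vec.subspace_inter)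
    then have L_sub: "L \<subseteq> \<zeta> p"
      using polarity_subset_swap[OF pol subspace_pg_point] sub by blast
    have "p \<noteq> a"
      using L_sub L nab by auto
    moreover have "p \<subseteq> \<zeta> a"
      using L_sub L(2) polarity_subset_swap[OF pol sub(1) subspace_pg_point[OF p(1)]] by auto
    ultimately have "L \<subseteq> \<zeta> a"
      using line_subset_if_two_points[OF L(1) dL Z(2) p(1,2) _ a L(2) self[OF a]] by blast
    with L nab show False
      by auto
  qed
  then have "L \<inter> \<zeta> L = {0}"
    using vec.subspace_0[OF L(1)] vec.subspace_0[OF Z(1)] by auto
  with L dL show ?thesis
    by blast
qed

text \<open>The sum of \<open>L\<close> and \<open>\<zeta> L\<close> is direct, so their dimensions
  add up to at most 4; the general lower bound makes this an equality.\<close>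

lemma hyperbolic_line_polar_dim:
  fixes \<zeta> :: "('a::field ^ 4) set \<Rightarrow> ('a ^ 4) set"
  assumes "polarity \<zeta>" "vec.subspace L" "vec.dim L = 2" "L \<inter> \<zeta> L = {0}"
  shows "vec.dim (\<zeta> L) = 2"
proof -
  have "vec.dim {x + y |x y. x \<in> L \<and> y \<in> \<zeta> L} + vec.dim (L \<inter> \<zeta> L) = vec.dim L + vec.dim (\<zeta> L)"
    by (rule vec.dim_sums_Int[OF assms(2) polarity_subspace[OF assms(1,2)]])
  then have "vec.dim L + vec.dim (\<zeta> L) \<le> 4"
    using dim_subset_UNIV_cart_gen[of "{x + y |x y. x \<in> L \<and> y \<in> \<zeta> L}"] by (simp add: assms(4))
  then show ?thesis
    using polarity_dim_ge[OF assms(1,2)] assms(3) by simp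
qed

text \<open>Apart from \<open>u\<close> itself, the neighbours on \<open>L\<close> are the points of
  \<open>L \<inter> \<zeta> u\<close>. This is all of \<open>L\<close> if \<open>u\<close> lies in
  \<open>\<zeta> L\<close>, and a single point otherwise. When \<open>u\<close> lies on
  \<open>L\<close>, that single point is \<open>u\<close>, which is not its own neighbour.\<close>

lemma card_neighbours_on_hyperbolic_line:
  fixes \<zeta> :: "('a::{field,finite} ^ 4) set \<Rightarrow> ('a ^ 4) set"
  assumes "symplectic_polarity \<zeta>" and L: "vec.subspace L" "vec.dim L = 2" and disj: "L \<inter> \<zeta> L = {0}"
    and u: "u \<in> pg_points"
  shows "card {w \<in> neighbours Sp4_vertices (Sp4_adj \<zeta>) u. w \<subseteq> L} =
    (if u \<subseteq> \<zeta> L then CARD('a) + 1 else if u \<subseteq> L then 0 else 1)"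
proof -
  have pol: "polarity \<zeta>" and self: "u \<subseteq> \<zeta> u"
    using assms(1) u by (auto simp: symplectic_polarity_def)
  note us = subspace_pg_point[OF u]
  have Z: "vec.subspace (\<zeta> u)"
    using polarity_subspace[OF pol us] .
  have nb: "{w \<in> neighbours Sp4_vertices (Sp4_adj \<zeta>) u. w \<subseteq> L} =
      {w \<in> pg_points. w \<subseteq> L \<inter> \<zeta> u} - {u}"
    using u by (auto simp: neighbours_def Sp4_vertices_def Sp4_adj_def)
  show ?thesis
  proof (cases "u \<subseteq> \<zeta> L")
    case True
    then have "L \<inter> \<zeta> u = L"
      using polarity_subset_swap[OF pol us L(1)] by auto
    moreover have "\<not> u \<subseteq> L"
      using True disj pg_point_not_subset_zero[OF u] by auto
    ultimately show ?thesis
      using True card_pg_points_line[OF L] by (simp add: nb)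
  next
    case False
    then have not_sub: "\<not> L \<subseteq> \<zeta> u"
      using polarity_subset_swap[OF pol L(1) us] by auto
    \<comment> \<open>A line and a plane have dimensions 2 and 3, too large for a direct sum in
      dimension 4.\<close>
    have "\<not> L \<inter> \<zeta> u \<subseteq> {0}"
    proof
      assume "L \<inter> \<zeta> u \<subseteq> {0}"
      then have "vec.dim (L \<inter> \<zeta> u) = 0"
        by simp
      with vec.dim_sums_Int[OF L(1) Z] polarity_point_dim[OF pol u] L(2)
      show False
        using dim_subset_UNIV_cart_gen[of "{x + y |x y. x \<in> L \<and> y \<in> \<zeta> u}"] by simp
    qed
    then obtain p where p: "p \<in> pg_points" "p \<subseteq> L \<inter> \<zeta> u"
      using ex_pg_point_subset[of "L \<inter> \<zeta> u"] L(1) Z by (auto simp: vec.subspace_inter)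
    have "{w \<in> pg_points. w \<subseteq> L \<inter> \<zeta> u} = {p}"
      using p not_sub line_subset_if_two_points[OF L Z] by blast
    \<comment> \<open>Here \<open>u \<subseteq> \<zeta> u\<close> matters: a point \<open>u\<close>
      of \<open>L\<close> lies in \<open>L \<inter> \<zeta> u\<close> and so must be the only point
      there.\<close>
    moreover have "u = p \<longleftrightarrow> u \<subseteq> L"
      using calculation p u self by blast
    ultimately show ?thesis
      using False by (simp add: nb)
  qed
qed

theorem theorem8:
  fixes \<zeta> :: "('a::{field,finite} ^ 4) set \<Rightarrow> ('a ^ 4) set"
    and q :: nat
  assumes "CARD('a) = q"
    and "symplectic_polarity \<zeta>"
  shows "weight_distribution_bound_tight Sp4_vertices (Sp4_adj \<zeta>) (- (real q + 1)) \<and>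
    (\<exists>f. eigenfunction Sp4_vertices (Sp4_adj \<zeta>) (- (real q + 1)) f \<and>
         card (nonzeroes Sp4_vertices f) = 2 * (q + 1))"
proof -
  have pol: "polarity \<zeta>"
    using assms(2) by (simp add: symplectic_polarity_def)
  obtain L where L: "vec.subspace L" "vec.dim L = 2" "L \<inter> \<zeta> L = {0}"
    using ex_hyperbolic_line[OF assms(2)] by blast
  define M where "M = \<zeta> L"
  \<comment> \<open>Since \<open>\<zeta> M = L\<close>, the two lines play symmetric roles, and the
    neighbour count applies to both.\<close>
  have M: "vec.subspace M" "vec.dim M = 2" "M \<inter> \<zeta> M = {0}" and zetaM: "\<zeta> M = L"
    using L polarity_subspace[OF pol] polarity_invol[OF pol] hyperbolic_line_polar_dim[OF pol]
    by (auto simp: M_def Int_commute)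
  have disj: "\<not> (w \<subseteq> L \<and> w \<subseteq> M)" if "w \<in> pg_points" for w
    using L(3) pg_point_not_subset_zero[OF that] by (auto simp: M_def)
  let ?N = "neighbours Sp4_vertices (Sp4_adj \<zeta>)"
  define f :: "('a ^ 4) set \<Rightarrow> real" where "f w = of_bool (w \<subseteq> L) - of_bool (w \<subseteq> M)" for w
  have "- (real q + 1) * f u = (\<Sum>w\<in>?N u. f w)" if u: "u \<in> pg_points" for u
  proof -
    have "(\<Sum>w\<in>?N u. f w) = real (card {w \<in> ?N u. w \<subseteq> L}) - real (card {w \<in> ?N u. w \<subseteq> M})"
      by (simp add: f_def sum_subtractf Int_def conj_commute)
    \<comment> \<open>The two counts, on \<open>L\<close> and on \<open>M\<close>, are
      \<open>0\<close> and \<open>q + 1\<close> for \<open>u\<close> on \<open>L\<close>,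
      \<open>q + 1\<close> and \<open>0\<close> for \<open>u\<close> on \<open>M\<close>, and
      \<open>1\<close> and \<open>1\<close> elsewhere. Their difference is
      \<open>- (q + 1) * f u\<close> in each case.\<close>
    then show ?thesis
      using card_neighbours_on_hyperbolic_line[OF assms(2) L u]
        card_neighbours_on_hyperbolic_line[OF assms(2) M u] disj[OF u] assms(1)
      by (auto simp: f_def zetaM M_def[symmetric])
  qed
  moreover have card: "card (nonzeroes Sp4_vertices f) = 2 * (q + 1)"
  proof -
    have "nonzeroes Sp4_vertices f = {w \<in> pg_points. w \<subseteq> L} \<union> {w \<in> pg_points. w \<subseteq> M}"
      using disj by (auto simp: nonzeroes_def Sp4_vertices_def f_def)
    also have "card \<dots> = card {w \<in> pg_points. w \<subseteq> L} + card {w \<in> pg_points. w \<subseteq> M}"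
      using disj by (intro card_Un_disjoint) auto
    finally show ?thesis
      using card_pg_points_line[OF L(1,2)] card_pg_points_line[OF M(1,2)] assms(1) by simp
  qed
  moreover have "\<exists>u\<in>Sp4_vertices. f u \<noteq> 0"
  proof -
    have "nonzeroes Sp4_vertices f \<noteq> {}"
      using card by force
    then show ?thesis
      by (auto simp: nonzeroes_def)
  qed
  ultimately have "eigenfunction Sp4_vertices (Sp4_adj \<zeta>) (- (real q + 1)) f"
    by (simp add: eigenfunction_def Sp4_vertices_def)
  \<comment> \<open>The eigenvalue is negative, so the bound is \<open>- 2 * \<theta>\<close>, that
    is \<open>2 * (q + 1)\<close>; the same \<open>f\<close> witnesses both conjuncts.\<close>
  with card show ?thesis
    unfolding weight_distribution_bound_tight_def weight_distribution_bound_def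
    by (auto intro!: exI[of _ f])
qed

end
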